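(* Let $n\ge1$, let $c=(c_1,\dots,c_n)$ be a vector of non-negative integers, not all zero, and let $\pi$ be a uniformly random permutation of $\{1,\dots,n\}$. Set $C_i=c_{\pi(i)}$ for $1\le i\le n$, and let $S_j=\sum_{i\le j}C_i^2$ for $1\le j\le n$. Let $\Delta=\max_{1\le i\le n}c_i$ and $\sigma^2(c)=\sum_{i\le n}c_i^2=S_n$. Then for all real $\lambda\ge2$ and all integers $1\le k\le n$, $$\mathbf{P}\Big(S_k\ge\lambda\frac{k}{n}S_n\Big)\le\exp\left(-\frac{3\sigma^2(c)}{16n}\cdot\frac{\lambda k}{\Delta^2}\right).$$
   Context: Standard notation only. Note that $S_n$ is deterministic. *)

theory Defs
  imports "HOL-Probability.Probability" "HOL-Combinatorics.Permutations"
begin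

text \<open>
  A vector \<open>c = (c\<^sub>1, \<dots>, c\<^sub>n)\<close> of non-negative integers is a function \<open>c :: nat \<Rightarrow> nat\<close> of which
  only the values on \<open>{1..n}\<close> are used.
\<close>

definition uniform_perm :: "nat \<Rightarrow> (nat \<Rightarrow> nat) pmf" where
  "uniform_perm n = pmf_of_set {p. p permutes {1..n}}"

definition permuted_entry :: "(nat \<Rightarrow> nat) \<Rightarrow> (nat \<Rightarrow> nat) \<Rightarrow> nat \<Rightarrow> nat" where
  "permuted_entry c p i = c (p i)"

definition partial_square_sum :: "(nat \<Rightarrow> nat) \<Rightarrow> (nat \<Rightarrow> nat) \<Rightarrow> nat \<Rightarrow> nat" where
  "partial_square_sum c p j = (\<Sum>i=1..j. (permuted_entry c p i)\<^sup>2)"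

definition max_entry :: "nat \<Rightarrow> (nat \<Rightarrow> nat) \<Rightarrow> nat" where
  "max_entry n c = Max (c ` {1..n})"

definition sigma_sq :: "nat \<Rightarrow> (nat \<Rightarrow> nat) \<Rightarrow> nat" where
  "sigma_sq n c = (\<Sum>i=1..n. (c i)\<^sup>2)"

lemma partial_square_sum_full:
  assumes "p permutes {1..n}"
  shows "partial_square_sum c p n = sigma_sq n c"
  using sum.permute[OF assms, of "\<lambda>i. (c i)\<^sup>2"]
  by (simp add: partial_square_sum_def permuted_entry_def sigma_sq_def o_def)

end

theory Submission
  imports Defs
begin

text \<open>
  Put \<open>x\<^sub>i = c\<^sub>i\<^sup>2 / \<Delta>\<^sup>2 \<in> [0, 1]\<close>, so that \<open>2 powr x\<^sub>i \<le> 1 + x\<^sub>i\<close>. Sampling without replacement is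
  negatively correlated: for non-negative weights \<open>a\<close> the mean of the product of \<open>k\<close> sampled
  weights is at most the \<open>k\<close>-th power of the mean of \<open>a\<close> (Maclaurin). With \<open>a = 1 + x\<close> this bounds
  the mean of \<open>2 powr (S\<^sub>k / \<Delta>\<^sup>2)\<close> by \<open>(1 + m / k)\<^sup>k \<le> exp m\<close>, where \<open>m = k \<sigma>\<^sup>2 / (n \<Delta>\<^sup>2)\<close>. Markov's
  inequality gives the bound \<open>exp (m - \<lambda> m ln 2)\<close>, which suffices for \<open>\<lambda> \<ge> 2\<close> because
  \<open>ln 2 \<ge> 11/16\<close>.
\<close>

lemma sum_permutes_transpose:
  assumes "j \<in> S" "l \<in> S"
  shows "(\<Sum>p | p permutes S. f p) = (\<Sum>p | p permutes S. f (p \<circ> Transposition.transpose j l))"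
  using sum_permutations_compose_right[OF permutes_swap_id[OF assms]] .

text \<open>Swapping positions \<open>j\<close> and \<open>l\<close> is a bijection on the
  permutations of \<open>S\<close>. For \<open>j\<close> outside \<open>K\<close> it turns one side
  into the other. For \<open>j\<close> in \<open>K\<close> the right side carries
  \<open>(a (p j))^2\<close> where the left side has \<open>a (p j) * a (p l)\<close>; AM-GM and the
  same swap compare the two.\<close>

lemma sum_permutes_prod_insert_le:
  fixes a :: "'a \<Rightarrow> real"
  assumes "finite S" "K \<subseteq> S" "l \<in> S" "l \<notin> K" "j \<in> S" and nonneg: "\<And>i. i \<in> S \<Longrightarrow> 0 \<le> a i"
  shows "(\<Sum>p | p permutes S. \<Prod>i\<in>insert l K. a (p i))
       \<le> (\<Sum>p | p permutes S. (\<Prod>i\<in>K. a (p i)) * a (p j))"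
proof (cases "j \<in> K")
  case False
  have "(\<Sum>p | p permutes S. (\<Prod>i\<in>K. a (p i)) * a (p j))
      = (\<Sum>p | p permutes S. (\<Prod>i\<in>K. a ((p \<circ> Transposition.transpose j l) i)) * a ((p \<circ> Transposition.transpose j l) j))"
    by (rule sum_permutes_transpose) (use assms in auto)
  also have "\<dots> = (\<Sum>p | p permutes S. \<Prod>i\<in>insert l K. a (p i))"
  proof (rule sum.cong[OF refl])
    fix p
    have "(\<Prod>i\<in>K. a ((p \<circ> Transposition.transpose j l) i)) = (\<Prod>i\<in>K. a (p i))"
      by (rule prod.cong) (use False assms in \<open>auto simp: Transposition.transpose_def\<close>)
    then show "(\<Prod>i\<in>K. a ((p \<circ> Transposition.transpose j l) i)) * a ((p \<circ> Transposition.transpose j l) j)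
        = (\<Prod>i\<in>insert l K. a (p i))"
      using assms finite_subset[OF assms(2,1)] by (simp add: mult.commute)
  qed
  finally show ?thesis by simp
next
  case True
  \<comment> \<open>\<open>Q\<close> omits the factor at \<open>j\<close>, and \<open>l\<close> is
    not in \<open>K\<close>, so \<open>Q\<close> is invariant under the swap; hence the squares at
    \<open>j\<close> and at \<open>l\<close> have equal sums when weighted by
    \<open>Q\<close>.\<close>
  define Q where "Q p = (\<Prod>i\<in>K - {j}. a (p i))" for p
  have fin: "finite K" using assms finite_subset by blast
  have prod_K: "(\<Prod>i\<in>K. a (p i)) = a (p j) * Q p" for p
    unfolding Q_def using prod.remove[OF fin True] by simp
  have Q_transpose: "Q (p \<circ> Transposition.transpose j l) = Q p" for p
    unfolding Q_def by (rule prod.cong) (use assms in \<open>auto simp: Transposition.transpose_def\<close>)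
  have Q_nonneg: "0 \<le> Q p" if "p permutes S" for p
    unfolding Q_def using assms permutes_in_image[OF that] by (intro prod_nonneg) auto
  have swap: "(\<Sum>p | p permutes S. Q p * (a (p j))\<^sup>2) = (\<Sum>p | p permutes S. Q p * (a (p l))\<^sup>2)"
    by (subst sum_permutes_transpose[of j _ l]) (use assms in \<open>auto simp: Q_transpose\<close>)
  have "2 * (\<Sum>p | p permutes S. \<Prod>i\<in>insert l K. a (p i))
      = (\<Sum>p | p permutes S. Q p * (2 * a (p j) * a (p l)))"
    using assms fin by (simp add: prod_K sum_distrib_left mult_ac)
  also have "\<dots> \<le> (\<Sum>p | p permutes S. Q p * ((a (p j))\<^sup>2 + (a (p l))\<^sup>2))"
    by (intro sum_mono mult_left_mono sum_squares_bound) (auto intro: Q_nonneg)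
  also have "\<dots> = 2 * (\<Sum>p | p permutes S. Q p * (a (p j))\<^sup>2)"
    by (simp add: distrib_left sum.distrib swap)
  also have "\<dots> = 2 * (\<Sum>p | p permutes S. (\<Prod>i\<in>K. a (p i)) * a (p j))"
    by (simp add: prod_K power2_eq_square mult_ac)
  finally show ?thesis by simp
qed

text \<open>Induction on \<open>K\<close>: averaging the exchange inequality over all
  \<open>j\<close> in \<open>S\<close> replaces the weight at the new position by the mean of
  \<open>a\<close>, because the sum of \<open>a (p j)\<close> over \<open>j\<close> in
  \<open>S\<close> is the same for every permutation \<open>p\<close>.\<close>

lemma sum_permutes_prod_le:
  fixes a :: "'a \<Rightarrow> real"
  assumes "finite S" "K \<subseteq> S" and nonneg: "\<And>i. i \<in> S \<Longrightarrow> 0 \<le> a i"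
  shows "(\<Sum>p | p permutes S. \<Prod>i\<in>K. a (p i))
       \<le> fact (card S) * ((\<Sum>i\<in>S. a i) / card S) ^ card K"
proof -
  have "finite K" using assms finite_subset by blast
  then show ?thesis using assms(2)
  proof (induction K)
    case empty
    then show ?case using card_permutations[OF refl assms(1)] by simp
  next
    case (insert l K)
    define A where "A = (\<Sum>i\<in>S. a i)"
    have S: "card S > 0" using insert assms(1) card_gt_0_iff by blast
    have A: "0 \<le> A" unfolding A_def by (intro sum_nonneg nonneg)
    have "card S * (\<Sum>p | p permutes S. \<Prod>i\<in>insert l K. a (p i))
        = (\<Sum>j\<in>S. \<Sum>p | p permutes S. \<Prod>i\<in>insert l K. a (p i))" by simp
    also have "\<dots> \<le> (\<Sum>j\<in>S. \<Sum>p | p permutes S. (\<Prod>i\<in>K. a (p i)) * a (p j))"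
      by (intro sum_mono sum_permutes_prod_insert_le) (use insert assms in auto)
    also have "\<dots> = (\<Sum>p | p permutes S. (\<Prod>i\<in>K. a (p i)) * (\<Sum>j\<in>S. a (p j)))"
      by (subst sum.swap) (simp add: sum_distrib_left)
    also have "\<dots> = (\<Sum>p | p permutes S. (\<Prod>i\<in>K. a (p i)) * A)"
      unfolding A_def by (intro sum.cong refl) (auto simp: sum.permute[of _ S a] o_def)
    also have "\<dots> = A * (\<Sum>p | p permutes S. \<Prod>i\<in>K. a (p i))"
      by (simp add: sum_distrib_left mult.commute)
    also have "\<dots> \<le> A * (fact (card S) * (A / card S) ^ card K)"
      using insert A by (intro mult_left_mono) (auto simp: A_def)
    finally show ?case
      using S insert by (simp add: A_def field_simps)
  qed
qed

text \<open>By convexity \<open>exp\<close> lies below its chord over [0, ln 2], which rises from 1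
  to 2.\<close>

lemma exp_ln2_mult_le:
  fixes x :: real
  assumes "0 \<le> x" "x \<le> 1"
  shows "exp (ln 2 * x) \<le> 1 + x"
  using convex_onD[OF exp_convex, of x 0 "ln 2"] assms by (simp add: algebra_simps)

text \<open>The constant is 1/2 + 3/16: for \<open>lam\<close> at least 2 it gives
  \<open>lam * (ln 2 - 3/16) >= 1\<close>, which is what absorbs the factor \<open>exp m\<close> in
  the final bound.\<close>

lemma ln2_ge_11_16: "ln (2::real) \<ge> 11 / 16"
  using ln_approx_bounds[of 2 2] by (simp add: eval_nat_numeral)

theorem proposition1p13:
  fixes n k :: nat and c :: "nat \<Rightarrow> nat" and lam :: real
  assumes "n \<ge> 1"
    and "\<exists>i\<in>{1..n}. c i \<noteq> 0"
    and "lam \<ge> 2"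
    and "1 \<le> k" and "k \<le> n"
  shows "measure_pmf.prob (uniform_perm n)
           {p. real (partial_square_sum c p k)
                 \<ge> lam * (real k / real n) * real (partial_square_sum c p n)}
         \<le> exp (- (3 * real (sigma_sq n c) / (16 * real n)
                    * (lam * real k / (real (max_entry n c))\<^sup>2)))"
proof -
  define D where "D = (real (max_entry n c))\<^sup>2"
  define x where "x i = (real (c i))\<^sup>2 / D" for i
  \<comment> \<open>The mean of the sum of \<open>x (p i)\<close> over \<open>i\<close> in
    \<open>{1..k}\<close>; after division by \<open>D\<close> the event says that this sum is at
    least \<open>lam * m\<close>.\<close>
  define m where "m = k * (\<Sum>i=1..n. x i) / n"
  let ?P = "{p. p permutes {1..n}}"
  let ?B = "{p. real (partial_square_sum c p k)
                 \<ge> lam * (real k / real n) * real (partial_square_sum c p n)}"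
  have le_max: "c i \<le> max_entry n c" if "i \<in> {1..n}" for i
    unfolding max_entry_def using that by (intro Max_ge) auto
  then have D: "0 < D" using assms(2) unfolding D_def by fastforce
  have x: "0 \<le> x i" "i \<in> {1..n} \<Longrightarrow> x i \<le> 1" for i
    using D le_max[of i] by (auto simp: x_def D_def divide_le_eq_1 power_mono)
  have m: "0 \<le> m" unfolding m_def using x by (simp add: sum_nonneg)
  have sigma: "real (sigma_sq n c) = D * (\<Sum>i=1..n. x i)"
    using D by (simp add: sigma_sq_def x_def sum_distrib_left)
  have finP: "finite ?P" by (rule finite_permutations) simp
  have cardP: "card ?P = fact n" using card_permutations[of "{1..n}" n] by simp

  have large: "exp (ln 2 * (lam * m)) \<le> (\<Prod>i=1..k. 1 + x (p i))" if p: "p \<in> ?P \<inter> ?B" for p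
  proof -
    have perm: "p permutes {1..n}" using p by simp
    have "real (partial_square_sum c p k) = D * (\<Sum>i=1..k. x (p i))"
      using D by (simp add: partial_square_sum_def permuted_entry_def x_def sum_distrib_left)
    then have "D * (lam * m) \<le> D * (\<Sum>i=1..k. x (p i))"
      using p by (simp add: partial_square_sum_full[OF perm] sigma m_def mult_ac)
    then have "lam * m \<le> (\<Sum>i=1..k. x (p i))" using D by simp
    then have "exp (ln 2 * (lam * m)) \<le> exp (\<Sum>i=1..k. ln 2 * x (p i))"
      by (simp flip: sum_distrib_left)
    also have "\<dots> = (\<Prod>i=1..k. exp (ln 2 * x (p i)))" by (simp add: exp_sum)
    also have "\<dots> \<le> (\<Prod>i=1..k. 1 + x (p i))"
    proof (intro prod_mono conjI exp_ln2_mult_le x)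
      show "p i \<in> {1..n}" if "i \<in> {1..k}" for i
        using that assms(5) permutes_in_image[OF perm, of i] by simp
    qed auto
    finally show ?thesis .
  qed
  \<comment> \<open>Markov's inequality in counting form: each permutation in the event contributes
    at least \<open>exp (ln 2 * (lam * m))\<close> to the sum of products, and the others contribute
    non-negative amounts.\<close>
  have "card (?P \<inter> ?B) * exp (ln 2 * (lam * m)) \<le> (\<Sum>p\<in>?P \<inter> ?B. \<Prod>i=1..k. 1 + x (p i))"
    using sum_mono[OF large, of "?P \<inter> ?B"] by simp
  also have "\<dots> \<le> (\<Sum>p\<in>?P. \<Prod>i=1..k. 1 + x (p i))"
    by (intro sum_mono2 finP prod_nonneg) (auto intro!: add_nonneg_nonneg x)
  also have "\<dots> \<le> fact n * ((\<Sum>i=1..n. 1 + x i) / n) ^ k"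
    using sum_permutes_prod_le[of "{1..n}" "{1..k}" "\<lambda>i. 1 + x i"] assms(5) x(1)
    by (simp add: add_nonneg_nonneg)
  also have "(\<Sum>i=1..n. 1 + x i) / n = 1 + m / k"
    using assms(1,4) by (simp add: m_def sum.distrib field_simps)
  also have "fact n * (1 + m / k) ^ k \<le> fact n * exp (m / k) ^ k"
    using m by (intro mult_left_mono power_mono exp_ge_add_one_self) auto
  also have "exp (m / k) ^ k = exp m"
    using assms(4) by (simp flip: exp_of_nat_mult)
  finally have count: "card (?P \<inter> ?B) * exp (ln 2 * (lam * m)) \<le> fact n * exp m" .

  have "1 * m \<le> (lam * (ln 2 - 3 / 16)) * m"
    using mult_mono[of 2 lam "1 / 2" "ln 2 - 3 / 16"] assms(3) ln2_ge_11_16 m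
    by (intro mult_right_mono) auto
  then have exponent: "m - ln 2 * (lam * m) \<le> - (3 / 16 * lam * m)"
    by (simp add: algebra_simps)

  have "?P \<noteq> {}" using permutes_id by blast
  then have "measure_pmf.prob (uniform_perm n) ?B = card (?P \<inter> ?B) / fact n"
    using finP by (simp only: uniform_perm_def measure_pmf_of_set cardP of_nat_fact not_False_eq_True)
  also have "\<dots> \<le> exp (m - ln 2 * (lam * m))"
    using count by (simp add: exp_diff field_simps)
  also have "\<dots> \<le> exp (- (3 / 16 * lam * m))" using exponent by simp
  also have "3 / 16 * lam * m = 3 * real (sigma_sq n c) / (16 * real n)
      * (lam * real k / (real (max_entry n c))\<^sup>2)"
    using D by (simp add: sigma m_def flip: D_def)
  finally show ?thesis .
qed

end
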